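(* For every integer $n\ge 1$, $$P^{\mathrm{Abs}}_{D_n}(q,1,-1)=-\tfrac{1}{2}(q-1)^{n-1}\left((1+q)^n+(1-q)^n\right).$$
   Context: $B_n$ is the set of pairs $\sigma=(z,\tau)$ with $z=(z_1,\dots,z_n)\in\{0,1\}^n$, $\tau\in S_n$ (signed permutations), and $D_n=\{\sigma\in B_n:\sum_i z_i\equiv 0 \pmod 2\}$. Statistics: $\mathrm{exc}(|\sigma|)=\#\{i\in[n]:\tau(i)>i\}$; $\mathrm{csum}(\sigma)=\sum_{i=1}^n z_i$ (as integers); $\mathrm{cyc}(\sigma)$ = number of cycles of $\tau$; $\mathrm{fix}(\sigma)=\#\{i:\tau(i)=i\}$. Define $\mathrm{exc}^{\mathrm{Abs}}(\sigma)=\mathrm{exc}(|\sigma|)+\mathrm{csum}(\sigma)$ and $P^{\mathrm{Abs}}_{D_n}(q,t,s)=\sum_{\sigma\in D_n}q^{\mathrm{exc}^{\mathrm{Abs}}(\sigma)}t^{\mathrm{fix}(\sigma)}s^{\mathrm{cyc}(\sigma)}$. *)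

theory Defs
  imports Complex_Main "HOL-Library.FuncSet" "HOL-Combinatorics.Permutations" "HOL-Combinatorics.Orbits"
begin

type_synonym signed_perm = "(nat \<Rightarrow> nat) \<times> (nat \<Rightarrow> nat)"

definition B :: "nat \<Rightarrow> signed_perm set" where
  "B n = ({1..n} \<rightarrow>\<^sub>E {0, 1}) \<times> {\<tau>. \<tau> permutes {1..n}}"

definition csum :: "nat \<Rightarrow> signed_perm \<Rightarrow> nat" where
  "csum n \<sigma> = (\<Sum>i = 1..n. fst \<sigma> i)"

definition D :: "nat \<Rightarrow> signed_perm set" where
  "D n = {\<sigma> \<in> B n. even (csum n \<sigma>)}"

definition exc_under :: "nat \<Rightarrow> signed_perm \<Rightarrow> nat" where
  "exc_under n \<sigma> = card {i \<in> {1..n}. snd \<sigma> i > i}"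

definition exc_Abs :: "nat \<Rightarrow> signed_perm \<Rightarrow> nat" where
  "exc_Abs n \<sigma> = exc_under n \<sigma> + csum n \<sigma>"

definition fixp :: "nat \<Rightarrow> signed_perm \<Rightarrow> nat" where
  "fixp n \<sigma> = card {i \<in> {1..n}. snd \<sigma> i = i}"

text \<open>Each cycle is identified with its support; fixed points count as cycles of length one.\<close>

definition cyc :: "nat \<Rightarrow> signed_perm \<Rightarrow> nat" where
  "cyc n \<sigma> = card (orbit (snd \<sigma>) ` {1..n})"

definition P_Abs_D :: "nat \<Rightarrow> 'a::comm_ring_1 \<Rightarrow> 'a \<Rightarrow> 'a \<Rightarrow> 'a" where
  "P_Abs_D n q t s = (\<Sum>\<sigma>\<in>D n. q ^ exc_Abs n \<sigma> * t ^ fixp n \<sigma> * s ^ cyc n \<sigma>)"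

end

theory Submission
  imports Defs
begin

text \<open>
  The sum over \<open>D\<^sub>n\<close> factors into a sum over sign vectors and a sum over permutations. The first is the
  even part of \<open>(1 + q)\<^sup>n\<close>. For the second, \<open>(-1)\<close> to the number of cycles equals \<open>(-1)\<^sup>n\<close> times the
  sign, so it is up to sign the determinant of the matrix with entries \<open>q\<close> above the diagonal and
  \<open>1\<close> elsewhere. Its last two rows agree except in the last column, which gives the recursion with
  factor \<open>1 - q\<close>.
\<close>

section \<open>Number of cycles and sign\<close>

text \<open>As \<open>p\<close> fixes \<open>a\<close>, composing with the transposition splices
  \<open>a\<close> into the cycle of \<open>b\<close>, immediately before \<open>b\<close>; every
  other cycle is untouched.\<close>

lemma orbit_transpose_comp:
  assumes p: "p permutes S" and a: "a \<notin> S" and b: "b \<in> S" and x: "x \<in> S"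
  shows "orbit (transpose a b \<circ> p) x = (if b \<in> orbit p x then insert a (orbit p x) else orbit p x)"
proof -
  define r where "r = transpose a b \<circ> p"
  have pS: "p y \<in> S" if "y \<in> S" for y
    using p that by (simp add: permutes_in_image)
  have oS: "y \<in> S" if "y \<in> orbit p x" for y
    using that permutes_orbit_subset[OF p x] by auto
  have r_b: "r y = a" if "p y = b" for y
    using that by (simp add: r_def)
  have r_other: "r y = p y" if "y \<in> S" "p y \<noteq> b" for y
  proof -
    have "p y \<noteq> a" using pS[OF that(1)] a by auto
    then show ?thesis using that by (simp add: r_def transpose_apply_other)
  qed
  have r_a: "r a = b"
    using p a by (simp add: r_def permutes_not_in)
  \<comment> \<open>A step of \<open>p\<close> that lands on \<open>b\<close> becomes two steps of
    \<open>r\<close>, passing through \<open>a\<close>.\<close>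
  have fwd: "y \<in> orbit r x" if "y \<in> orbit p x" for y
    using that
  proof induction
    case base
    show ?case
    proof (cases "p x = b")
      case True
      then have "a \<in> orbit r x" using r_b orbit.base[of r x] by simp
      then show ?thesis using True r_a orbit.step[of a r x] by simp
    next
      case False
      then show ?thesis using r_other[OF x] orbit.base[of r x] by simp
    qed
  next
    case (step y)
    show ?case
    proof (cases "p y = b")
      case True
      then have "a \<in> orbit r x" using r_b step.IH orbit.step[of y r x] by simp
      then show ?thesis using True r_a orbit.step[of a r x] by simp
    next
      case False
      then show ?thesis using r_other[OF oS[OF step.hyps]] step.IH orbit.step[of y r x] by simp
    qed
  qed
  \<comment> \<open>The first disjunct carries \<open>b \<in> orbit p x\<close> because the step of
    \<open>r\<close> after \<open>a\<close> leads to \<open>b\<close>.\<close>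
  have bwd: "(y = a \<and> b \<in> orbit p x) \<or> y \<in> orbit p x" if "y \<in> orbit r x" for y
    using that
  proof induction
    case base
    show ?case
      using r_b[of x] r_other[OF x] orbit.base[of p x] by (cases "p x = b") auto
  next
    case (step y)
    then consider "y = a" "b \<in> orbit p x" | "y \<in> orbit p x" by blast
    then show ?case
    proof cases
      case 1
      then show ?thesis using r_a by simp
    next
      case 2
      then show ?thesis
        using r_b[of y] r_other[OF oS[OF 2]] orbit.step[OF 2] by (cases "p y = b") auto
    qed
  qed
  have "a \<in> orbit r x" if "b \<in> orbit p x"
    using that
  proof cases
    case base
    then show ?thesis using r_b[of x] orbit.base[of r x] by simp
  next
    case (step y)
    then show ?thesis using r_b[of y] orbit.step[OF fwd[of y]] by simp
  qed
  then have "orbit r x = (if b \<in> orbit p x then insert a (orbit p x) else orbit p x)"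
    using fwd bwd by auto
  then show ?thesis by (simp add: r_def)
qed

lemma card_orbits_transpose_comp:
  assumes fin: "finite S" and p: "p permutes S" and a: "a \<notin> S" and b: "b \<in> S"
  shows "card (orbit (transpose a b \<circ> p) ` insert a S) = card (orbit p ` S)"
proof -
  define r where "r = transpose a b \<circ> p"
  define f where "f = (\<lambda>X. if b \<in> X then insert a X else X)"
  have eq: "orbit r x = f (orbit p x)" if "x \<in> S" for x
    using orbit_transpose_comp[OF p a b that] by (simp add: r_def f_def)
  \<comment> \<open>The predecessor \<open>c\<close> of \<open>b\<close> under \<open>p\<close>
    satisfies \<open>r c = a\<close>, so \<open>a\<close> shares the orbit of \<open>c\<close> and
    adds no new one. Finiteness puts \<open>c\<close> in its own orbit.\<close>
  obtain c where c: "c \<in> S" "p c = b"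
    using p b by (metis permutes_in_image permutes_surj surjD)
  have "r permutes insert a S"
    unfolding r_def using p b
    by (intro permutes_compose[OF permutes_subset[OF p] permutes_swap_id]) auto
  then have "permutation r"
    using fin by (intro permutes_imp_permutation[of "insert a S"]) auto
  then have "c \<in> orbit r c" by (rule permutation_self_in_orbit)
  then have "orbit r (r c) = orbit r c"
    by (blast intro: orbit_trans orbit_swap orbit.base)
  moreover have "r c = a" using c by (simp add: r_def)
  ultimately have "orbit r ` insert a S = orbit r ` S"
    using c(1) by auto
  also have "\<dots> = f ` orbit p ` S"
    using eq by (simp add: image_image cong: image_cong)
  finally have "orbit r ` insert a S = f ` orbit p ` S" .
  \<comment> \<open>No orbit of \<open>p\<close> contains \<open>a\<close>, so deleting
    \<open>a\<close> undoes \<open>f\<close>.\<close>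
  moreover have "inj_on f (orbit p ` S)"
  proof (rule inj_on_inverseI[where g = "\<lambda>X. X - {a}"])
    fix X assume "X \<in> orbit p ` S"
    then have "a \<notin> X" using permutes_orbit_subset[OF p] a by auto
    then show "f X - {a} = X" by (simp add: f_def)
  qed
  ultimately show ?thesis by (simp add: r_def card_image)
qed

text \<open>Insert the points one at a time, writing \<open>p\<close> as
  \<open>transpose a b \<circ> p'\<close>. If \<open>b = a\<close>, a new one-point cycle appears
  and the sign is kept; otherwise the cycle count is kept and the sign flips, cancelling the change
  of \<open>(- 1) ^ card S\<close>.\<close>

lemma minus_one_power_card_orbits:
  assumes "finite S" "p permutes S"
  shows "(- 1) ^ card (orbit p ` S) = (- 1) ^ card S * sign p"
  using assms
proof (induction S arbitrary: p rule: finite_induct)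
  case empty
  then show ?case by (simp add: permutes_empty)
next
  case (insert a S)
  have "p \<in> {p. p permutes insert a S}" using insert.prems by simp
  then obtain b p' where p: "p = transpose a b \<circ> p'" and b: "b \<in> insert a S" and p': "p' permutes S"
    unfolding permutes_insert by auto
  note IH = insert.IH[OF p']
  show ?case
  proof (cases "b = a")
    case True
    then have p_eq: "p = p'" using p by simp
    have fixa: "p' a = a" using p' insert.hyps by (simp add: permutes_not_in)
    have "a \<notin> orbit p' x" if "x \<in> S" for x
      using permutes_orbit_subset[OF p' that] insert.hyps by auto
    moreover have "a \<in> orbit p' a" using orbit.base[of p' a] fixa by simp
    ultimately have "orbit p' a \<notin> orbit p' ` S" by auto
    then show ?thesis using IH insert.hyps p_eq by simp
  next
    case False
    then have bS: "b \<in> S" using b by simp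
    have "permutation p'" using p' insert.hyps permutation_permutes by blast
    then have "sign p = - sign p'"
      using False by (simp add: p sign_compose sign_swap_id permutation_swap_id)
    then show ?thesis
      using card_orbits_transpose_comp[OF insert.hyps(1) p' insert.hyps(2) bS, folded p] IH insert.hyps by simp
  qed
qed

section \<open>The determinant and its recursion\<close>

text \<open>The Leibniz expansion of the determinant, with row \<open>i\<close> and column
  \<open>p i\<close>.\<close>

definition signed_exc_sum :: "nat \<Rightarrow> 'a::field_char_0 \<Rightarrow> 'a" where
  "signed_exc_sum n q =
    (\<Sum>p | p permutes {1..n}. of_int (sign p) * (\<Prod>i=1..n. if i < p i then q else 1))"

lemma permutes_Suc_fixing_last:
  "{p. p permutes {1..Suc n} \<and> p (Suc n) = Suc n} = {p. p permutes {1..n}}"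
proof (intro Collect_cong iffI conjI)
  fix p :: "nat \<Rightarrow> nat"
  assume p: "p permutes {1..Suc n} \<and> p (Suc n) = Suc n"
  have "x \<in> {1..Suc n} - {1..n} \<longrightarrow> p x = x" for x
    using p by (cases "x = Suc n") auto
  then show "p permutes {1..n}"
    using p by (auto intro: permutes_superset)
next
  fix p :: "nat \<Rightarrow> nat"
  assume p: "p permutes {1..n}"
  then show "p permutes {1..Suc n}" by (rule permutes_subset) auto
  show "p (Suc n) = Suc n" using p by (rule permutes_not_in) auto
qed

text \<open>Precomposing with \<open>t\<close> swaps the roles of rows \<open>K\<close> and
  \<open>N\<close>, which differ only in column \<open>N\<close> (entries \<open>q\<close> and
  \<open>1\<close>). The permutations are split by the row that uses column \<open>N\<close>: row
  \<open>N\<close> in \<open>A1\<close>, row \<open>K\<close> in \<open>A2\<close>, an earlier row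
  in \<open>A3\<close>.\<close>

lemma signed_exc_sum_Suc_Suc:
  "signed_exc_sum (Suc (Suc m)) q = (1 - q) * signed_exc_sum (Suc m) q"
proof -
  define K where "K = Suc m"
  define N where "N = Suc K"
  define t where "t = transpose K N"
  define w :: "(nat \<Rightarrow> nat) \<Rightarrow> 'a" where
    "w p = of_int (sign p) * (\<Prod>i=1..N. if i < p i then q else 1)" for p
  define A where "A = {p. p permutes {1..N}}"
  define A1 where "A1 = {p \<in> A. p N = N}"
  define A2 where "A2 = {p \<in> A. p K = N}"
  define A3 where "A3 = {p \<in> A. p K \<noteq> N \<and> p N \<noteq> N}"
  have KN: "K \<noteq> N" "1 \<le> K" "K < N" by (simp_all add: K_def N_def)
  have t: "t permutes {1..N}"
    unfolding t_def by (rule permutes_swap_id) (use KN in auto)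
  have tt: "t \<circ> t = id" by (simp add: t_def)
  have pt: "p \<circ> t \<in> A" if "p \<in> A" for p
    using that t by (simp add: A_def permutes_compose)
  have ptt: "p \<circ> t \<circ> t = p" for p :: "nat \<Rightarrow> nat"
    by (simp add: comp_assoc tt)
  have tK: "t K = N" and tN: "t N = K" by (simp_all add: t_def)
  have sgn: "sign (p \<circ> t) = - sign p" if "p \<in> A" for p
  proof -
    have "permutation p" using that permutation_permutes by (auto simp: A_def)
    then show ?thesis
      using KN by (simp add: t_def sign_compose sign_swap_id permutation_swap_id)
  qed
  have le: "p i \<le> N" if "p \<in> A" "i \<in> {1..N}" for p i
    using that permutes_in_image[of p "{1..N}" i] by (auto simp: A_def)
  have prodN: "(\<Prod>i=1..N. g i) = (\<Prod>i=1..m. g i) * g K * g N" for g :: "nat \<Rightarrow> 'a"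
    by (simp add: N_def K_def)
  have prod_t: "(\<Prod>i=1..m. if i < (p \<circ> t) i then q else 1) = (\<Prod>i=1..m. if i < p i then q else 1)"
    for p by (intro prod.cong) (auto simp: t_def transpose_def K_def N_def)
  have w_t: "w (p \<circ> t) = - of_int (sign p) * (\<Prod>i=1..m. if i < p i then q else 1)
      * (if p N = N then q else 1)" if "p \<in> A" for p
  proof -
    \<comment> \<open>As \<open>K = N - 1\<close>, row \<open>K\<close> has an excedance only at
      column \<open>N\<close>, and row \<open>N\<close> never has one.\<close>
    have "K < p N \<longleftrightarrow> p N = N" "\<not> N < p K"
      using le[OF that, of N] le[OF that, of K] KN by (auto simp: N_def)
    then show ?thesis
      unfolding w_def prodN prod_t sgn[OF that] by (simp add: tK tN)
  qed
  have w_eq: "w p = of_int (sign p) * (\<Prod>i=1..m. if i < p i then q else 1)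
      * (if p K = N then q else 1)" if "p \<in> A" for p
  proof -
    have "K < p K \<longleftrightarrow> p K = N" "\<not> N < p N"
      using le[OF that, of N] le[OF that, of K] KN by (auto simp: N_def)
    then show ?thesis
      unfolding w_def prodN by simp
  qed
  have inj: "p K \<noteq> p N" if "p \<in> A" for p
    using that KN permutes_inj[of p "{1..N}"] by (auto simp: A_def inj_eq)
  \<comment> \<open>The fixed point \<open>N\<close> contributes the factor \<open>1\<close>,
    leaving the weight of a permutation of \<open>{1..K}\<close>.\<close>
  have A1_w: "w p = of_int (sign p) * (\<Prod>i=1..K. if i < p i then q else 1)" if "p \<in> A1" for p
    using that by (simp add: w_def N_def A1_def)
  have "A1 = {p. p permutes {1..K}}"
    using permutes_Suc_fixing_last[of K] by (simp add: A1_def A_def N_def)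
  then have S1: "sum w A1 = signed_exc_sum K q"
    using A1_w by (simp add: signed_exc_sum_def)
  \<comment> \<open>The swap is a bijection between \<open>A1\<close> and \<open>A2\<close>; it
    flips the sign and replaces the entry \<open>1\<close> by \<open>q\<close>.\<close>
  have "sum w A2 = (\<Sum>p\<in>A1. w (p \<circ> t))"
    by (rule sum.reindex_bij_witness[where i = "\<lambda>p. p \<circ> t" and j = "\<lambda>p. p \<circ> t"])
      (auto simp: A1_def A2_def ptt tK tN intro: pt)
  also have "\<dots> = (\<Sum>p\<in>A1. - q * w p)"
  proof (rule sum.cong)
    fix p assume "p \<in> A1"
    then have "p \<in> A" "p N = N" "p K \<noteq> N" using inj[of p] by (auto simp: A1_def)
    then show "w (p \<circ> t) = - q * w p" by (simp add: w_t w_eq)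
  qed simp
  finally have S2: "sum w A2 = - q * sum w A1" by (simp add: sum_distrib_left)
  \<comment> \<open>On \<open>A3\<close> the swap only flips the sign, so the sum equals its own
    negative and vanishes in characteristic 0.\<close>
  have "sum w A3 = (\<Sum>p\<in>A3. w (p \<circ> t))"
    by (rule sum.reindex_bij_witness[where i = "\<lambda>p. p \<circ> t" and j = "\<lambda>p. p \<circ> t"])
      (auto simp: A3_def ptt tK tN intro: pt)
  also have "\<dots> = (\<Sum>p\<in>A3. - w p)"
    by (rule sum.cong) (auto simp: A3_def w_t w_eq)
  finally have S3: "sum w A3 = 0" by (simp add: sum_negf)
  have fin: "finite A" by (simp add: A_def finite_permutations)
  have "A = A1 \<union> (A2 \<union> A3)" "A1 \<inter> (A2 \<union> A3) = {}" "A2 \<inter> A3 = {}"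
    by (auto simp: A1_def A2_def A3_def dest: inj)
  then have "sum w A = sum w A1 + (sum w A2 + sum w A3)"
    using fin by (metis finite_Un sum.union_disjoint)
  also have "\<dots> = (1 - q) * signed_exc_sum K q"
    using S1 S2 S3 by (simp add: algebra_simps)
  finally show ?thesis
    by (simp add: signed_exc_sum_def A_def w_def N_def K_def)
qed

lemma signed_exc_sum_Suc: "signed_exc_sum (Suc m) q = (1 - q) ^ m"
proof (induction m)
  case 0
  show ?case by (simp add: signed_exc_sum_def)
next
  case (Suc m)
  then show ?case by (simp add: signed_exc_sum_Suc_Suc)
qed

section \<open>Sums over sign vectors\<close>

lemma sum_signs_power:
  fixes q :: "'a::comm_ring_1"
  assumes "finite I"
  shows "(\<Sum>z\<in>I \<rightarrow>\<^sub>E {0, 1::nat}. q ^ (\<Sum>i\<in>I. z i)) = (1 + q) ^ card I"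
proof -
  have "(\<Sum>z\<in>I \<rightarrow>\<^sub>E {0, 1::nat}. q ^ (\<Sum>i\<in>I. z i)) = (\<Sum>z\<in>I \<rightarrow>\<^sub>E {0, 1::nat}. \<Prod>i\<in>I. q ^ z i)"
    by (simp add: power_sum)
  also have "\<dots> = (\<Prod>i\<in>I. \<Sum>k\<in>{0, 1::nat}. q ^ k)"
    using assms by (subst prod_sum_PiE) auto
  finally show ?thesis by simp
qed

lemma sum_even_signs_power:
  fixes q :: "'a::field_char_0"
  assumes "finite I"
  shows "(\<Sum>z | z \<in> I \<rightarrow>\<^sub>E {0, 1::nat} \<and> even (\<Sum>i\<in>I. z i). q ^ (\<Sum>i\<in>I. z i))
    = ((1 + q) ^ card I + (1 - q) ^ card I) / 2"
proof -
  let ?Z = "I \<rightarrow>\<^sub>E {0, 1::nat}"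
  have fin: "finite ?Z" using assms by (simp add: finite_PiE)
  have "(\<Sum>z | z \<in> ?Z \<and> even (\<Sum>i\<in>I. z i). q ^ (\<Sum>i\<in>I. z i))
    = (\<Sum>z\<in>?Z. if even (\<Sum>i\<in>I. z i) then q ^ (\<Sum>i\<in>I. z i) else 0)"
    using fin by (subst sum.inter_filter[symmetric]) simp_all
  \<comment> \<open>Averaging over \<open>q\<close> and \<open>- q\<close> keeps the even powers and
    kills the odd ones, which removes the parity condition.\<close>
  also have "\<dots> = (\<Sum>z\<in>?Z. (q ^ (\<Sum>i\<in>I. z i) + (- q) ^ (\<Sum>i\<in>I. z i)) / 2)"
    by (intro sum.cong) auto
  also have "\<dots> = ((1 + q) ^ card I + (1 + - q) ^ card I) / 2"
    unfolding sum_divide_distrib[symmetric] sum.distrib sum_signs_power[OF assms] ..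
  finally show ?thesis by simp
qed

theorem theorem4:
  fixes n :: nat and q :: "'a::field_char_0"
  assumes "n \<ge> 1"
  shows "P_Abs_D n q 1 (-1) = - (1 / 2) * (q - 1) ^ (n - 1) * ((1 + q) ^ n + (1 - q) ^ n)"
proof -
  let ?Z = "{z. z \<in> {1..n} \<rightarrow>\<^sub>E {0, 1::nat} \<and> even (\<Sum>i=1..n. z i)}"
  let ?S = "{p. p permutes {1..n}}"
  have D: "D n = ?Z \<times> ?S"
    by (auto simp: D_def B_def csum_def)
  have exc: "q ^ exc_under n (z, p) = (\<Prod>i=1..n. if i < p i then q else 1)" for z p
    by (simp add: exc_under_def prod.If_cases Int_def)
  have cyc: "(-1) ^ cyc n (z, p) = (-1) ^ n * (of_int (sign p) :: 'a)" if "p permutes {1..n}" for z p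
  proof -
    \<comment> \<open>The sign identity lives in the integers and is transported to the field by
      \<open>of_int\<close>.\<close>
    have "(of_int ((-1) ^ cyc n (z, p)) :: 'a) = of_int ((-1) ^ n * sign p)"
      using minus_one_power_card_orbits[OF _ that] by (simp add: cyc_def)
    then show ?thesis by simp
  qed
  obtain m where m: "n = Suc m" using assms by (cases n) auto
  have "P_Abs_D n q 1 (-1) = (\<Sum>z\<in>?Z. \<Sum>p\<in>?S. q ^ (\<Sum>i=1..n. z i) *
      ((-1) ^ n * (of_int (sign p) * (\<Prod>i=1..n. if i < p i then q else 1))))"
    unfolding P_Abs_D_def D sum.cartesian_product
    by (intro sum.cong) (auto simp: exc_Abs_def power_add exc cyc csum_def)
  also have "\<dots> = (\<Sum>z\<in>?Z. q ^ (\<Sum>i=1..n. z i)) * ((-1) ^ n * signed_exc_sum n q)"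
    unfolding signed_exc_sum_def by (simp only: sum_distrib_left[symmetric] sum_distrib_right[symmetric])
  also have "\<dots> = ((1 + q) ^ n + (1 - q) ^ n) / 2 * ((-1) ^ n * (1 - q) ^ m)"
    using sum_even_signs_power[of "{1..n}" q] signed_exc_sum_Suc[of m q] m by simp
  \<comment> \<open>Since \<open>n = Suc m\<close>, \<open>m\<close> of the factors
    \<open>-1\<close> turn \<open>1 - q\<close> into \<open>q - 1\<close>; the remaining one is the
    leading minus sign.\<close>
  also have "(-1) ^ n * (1 - q) ^ m = - ((q - 1) ^ m)"
    unfolding m by (simp add: power_mult_distrib[symmetric])
  finally show ?thesis by (simp add: m)
qed

end
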